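(* Let $(L,\cdot)$ be a quasigroup (respectively, a loop) with holomorph $H(L)$. Then $H(L)$ is an AIPQ (respectively, an AIPL) if and only if all of the following hold: 1. $AUM(L)$ is an abelian group; 2. $(\beta^{-1},\alpha,I)\in AUT(L)$ for all $\alpha,\beta\in AUM(L)$; and 3. $L$ is an AIPQ (respectively, an AIPL).
   Context: Mappings are written on the right of their arguments and composed from left to right. A quasigroup $(L,\cdot)$ is a non-empty set with a binary operation such that for all $a,b\in L$ the equations $a\cdot x=b$ and $y\cdot a=b$ have unique solutions $x,y\in L$; a loop is a quasigroup with a two-sided identity element $e$. For $x\in L$, the right inverse $x^\rho=xJ_\rho$ and left inverse $x^\lambda=xJ_\lambda$ are the elements with $x x^\rho=e^\rho$ and $x^\lambda x=e^\lambda$, where $e^\rho$ and $e^\lambda$ denote a right identity element and a left identity element of $L$ (assumed to exist whenever $x^\rho$, respectively $x^\lambda$, is used; both equal $e$ in a loop). $AUM(L)$ is the automorphism group of $(L,\cdot)$. $AUT(L)$ is the group of autotopisms of $(L,\cdot)$, i.e. triples $(A,B,C)$ of bijections of $L$ with $xA\cdot yB=(x\cdot y)C$ for all $x,y\in L$. $I$ is the identity map. The holomorph $H(L)=(H,\circ)$ is the set $H$ of pairs $(\alpha,x)$, $\alpha\in AUM(L)$, $x\in L$, with operation $(\alpha,x)\circ(\beta,y)=(\alpha\beta,\,x\beta\cdot y)$. A quasigroup (loop) is an automorphic inverse property quasigroup, AIPQ (automorphic inverse property loop, AIPL), if and only if it obeys the identity $(xy)^\rho=x^\rho y^\rho$ or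 $(xy)^\lambda=x^\lambda y^\lambda$. *)

theory Defs
  imports "HOL-Algebra.Bij"
begin

(* The field one plays no role in a quasigroup; only in a loop is it required to be the identity. *)
locale quasigroup =
  fixes G :: "('a, 'b) monoid_scheme" (structure)
  assumes nonempty: "carrier G \<noteq> {}"
    and m_closed: "\<lbrakk>x \<in> carrier G; y \<in> carrier G\<rbrakk> \<Longrightarrow> x \<otimes> y \<in> carrier G"
    and right_div: "\<lbrakk>a \<in> carrier G; b \<in> carrier G\<rbrakk> \<Longrightarrow> \<exists>!x. x \<in> carrier G \<and> a \<otimes> x = b"
    and left_div: "\<lbrakk>a \<in> carrier G; b \<in> carrier G\<rbrakk> \<Longrightarrow> \<exists>!y. y \<in> carrier G \<and> y \<otimes> a = b"

locale loop = quasigroup +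
  assumes one_closed: "\<one> \<in> carrier G"
    and l_one: "x \<in> carrier G \<Longrightarrow> \<one> \<otimes> x = x"
    and r_one: "x \<in> carrier G \<Longrightarrow> x \<otimes> \<one> = x"

definition right_identity :: "('a, 'b) monoid_scheme \<Rightarrow> 'a \<Rightarrow> bool" where
  "right_identity G e \<longleftrightarrow> e \<in> carrier G \<and> (\<forall>x \<in> carrier G. x \<otimes>\<^bsub>G\<^esub> e = x)"

definition left_identity :: "('a, 'b) monoid_scheme \<Rightarrow> 'a \<Rightarrow> bool" where
  "left_identity G e \<longleftrightarrow> e \<in> carrier G \<and> (\<forall>x \<in> carrier G. e \<otimes>\<^bsub>G\<^esub> x = x)"

(* The following descriptions are meaningful in a quasigroup that has a right (left) identity;
   see the uniqueness lemmas below. *)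
definition e_rho :: "('a, 'b) monoid_scheme \<Rightarrow> 'a" where
  "e_rho G = (THE e. right_identity G e)"

definition e_lambda :: "('a, 'b) monoid_scheme \<Rightarrow> 'a" where
  "e_lambda G = (THE e. left_identity G e)"

definition J_rho :: "('a, 'b) monoid_scheme \<Rightarrow> 'a \<Rightarrow> 'a" where
  "J_rho G x = (THE y. y \<in> carrier G \<and> x \<otimes>\<^bsub>G\<^esub> y = e_rho G)"

definition J_lambda :: "('a, 'b) monoid_scheme \<Rightarrow> 'a \<Rightarrow> 'a" where
  "J_lambda G x = (THE y. y \<in> carrier G \<and> y \<otimes>\<^bsub>G\<^esub> x = e_lambda G)"

(* A quasigroup need not have one-sided identities, so each identity of inverses carries the
   existence of the one-sided identity element that its inverses refer to. *)
definition right_AIP :: "('a, 'b) monoid_scheme \<Rightarrow> bool" where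
  "right_AIP G \<longleftrightarrow> (\<exists>e. right_identity G e) \<and>
     (\<forall>x \<in> carrier G. \<forall>y \<in> carrier G. J_rho G (x \<otimes>\<^bsub>G\<^esub> y) = J_rho G x \<otimes>\<^bsub>G\<^esub> J_rho G y)"

definition left_AIP :: "('a, 'b) monoid_scheme \<Rightarrow> bool" where
  "left_AIP G \<longleftrightarrow> (\<exists>e. left_identity G e) \<and>
     (\<forall>x \<in> carrier G. \<forall>y \<in> carrier G. J_lambda G (x \<otimes>\<^bsub>G\<^esub> y) = J_lambda G x \<otimes>\<^bsub>G\<^esub> J_lambda G y)"

definition AIPQ :: "('a, 'b) monoid_scheme \<Rightarrow> bool" where
  "AIPQ G \<longleftrightarrow> quasigroup G \<and> (right_AIP G \<or> left_AIP G)"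

definition AIPL :: "('a, 'b) monoid_scheme \<Rightarrow> bool" where
  "AIPL G \<longleftrightarrow> loop G \<and> (right_AIP G \<or> left_AIP G)"

definition AUT :: "('a, 'b) monoid_scheme \<Rightarrow> (('a \<Rightarrow> 'a) \<times> ('a \<Rightarrow> 'a) \<times> ('a \<Rightarrow> 'a)) set" where
  "AUT G = {(A, B, C). A \<in> Bij (carrier G) \<and> B \<in> Bij (carrier G) \<and> C \<in> Bij (carrier G) \<and>
     (\<forall>x \<in> carrier G. \<forall>y \<in> carrier G. A x \<otimes>\<^bsub>G\<^esub> B y = C (x \<otimes>\<^bsub>G\<^esub> y))}"

(* Multiplication in AutoGroup G is composition from right to left, so the left-to-right
   composite "first \<alpha>, then \<beta>" is the AutoGroup product of \<beta> and \<alpha>, in this order. *)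
definition holomorph :: "('a, 'b) monoid_scheme \<Rightarrow> (('a \<Rightarrow> 'a) \<times> 'a) monoid" where
  "holomorph G =
    \<lparr>carrier = carrier (AutoGroup G) \<times> carrier G,
     mult = \<lambda>(\<alpha>, x) (\<beta>, y). (\<beta> \<otimes>\<^bsub>AutoGroup G\<^esub> \<alpha>, \<beta> x \<otimes>\<^bsub>G\<^esub> y),
     one = (\<one>\<^bsub>AutoGroup G\<^esub>, \<one>\<^bsub>G\<^esub>)\<rparr>"

context quasigroup
begin

lemma right_identity_unique:
  assumes "right_identity G e" "right_identity G f"
  shows "e = f"
  using assms right_div[of e e] nonempty unfolding right_identity_def by metis

lemma left_identity_unique:
  assumes "left_identity G e" "left_identity G f"
  shows "e = f"
  using assms left_div[of e e] nonempty unfolding left_identity_def by metis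

lemma e_rho_eq: "right_identity G e \<Longrightarrow> e_rho G = e"
  unfolding e_rho_def using right_identity_unique by blast

lemma e_lambda_eq: "left_identity G e \<Longrightarrow> e_lambda G = e"
  unfolding e_lambda_def using left_identity_unique by blast

lemma J_rho:
  assumes "right_identity G e" "x \<in> carrier G"
  shows "J_rho G x \<in> carrier G" "x \<otimes> J_rho G x = e"
proof -
  have "\<exists>!y. y \<in> carrier G \<and> x \<otimes> y = e_rho G"
    using assms right_div e_rho_eq by (auto simp: right_identity_def)
  from theI'[OF this] show "J_rho G x \<in> carrier G" "x \<otimes> J_rho G x = e"
    using assms(1) by (auto simp: J_rho_def e_rho_eq)
qed

lemma J_lambda:
  assumes "left_identity G e" "x \<in> carrier G"
  shows "J_lambda G x \<in> carrier G" "J_lambda G x \<otimes> x = e"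
proof -
  have "\<exists>!y. y \<in> carrier G \<and> y \<otimes> x = e_lambda G"
    using assms left_div e_lambda_eq by (auto simp: left_identity_def)
  from theI'[OF this] show "J_lambda G x \<in> carrier G" "J_lambda G x \<otimes> x = e"
    using assms(1) by (auto simp: J_lambda_def e_lambda_eq)
qed

end

end

theory Submission
  imports Defs
begin

text \<open>
  Write \<open>J\<close> for the map sending an element of \<open>L\<close> to its right inverse (or to its left inverse).
  Solving for inverses in the holomorph gives, on either side,
  \<open>(\<alpha>, x) \<mapsto> (\<alpha>\<inverse>, \<alpha>\<inverse> (J x))\<close>, because automorphisms fix one-sided identities and hence commute
  with \<open>J\<close>. The left and the right inverse property of the holomorph are therefore the same
  computation, carried out in \<open>holomorph_inverse_map_hom_iff\<close> for any surjective map \<open>J\<close> that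
  commutes with all automorphisms.

  In that computation, comparing first components shows that inversion is multiplicative on the
  automorphism group, which means that the group is abelian. In the second components, identity
  automorphisms give that \<open>J\<close> is multiplicative on \<open>L\<close>. Cancelling automorphisms then leaves
  \<open>\<beta> (J x) \<cdot> J y = J x \<cdot> \<alpha> (J y)\<close>; as \<open>J\<close> is onto, \<open>J x\<close> and \<open>J y\<close> are arbitrary, and the identity
  says exactly that \<open>(\<beta>\<inverse>, \<alpha>, I)\<close> is an autotopism. All these steps can be reversed.

  The holomorph of a quasigroup (loop) is again one, and it has a one-sided identity exactly when
  \<open>L\<close> has one on the same side. So the right inverse property of the holomorph corresponds to the
  right one of \<open>L\<close>, and likewise on the left.
\<close>

section \<open>Cancellation and one-sided inverses\<close>

context quasigroup
begin

lemma l_cancel: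
  assumes "a \<in> carrier G" "x \<in> carrier G" "y \<in> carrier G" "a \<otimes> x = a \<otimes> y"
  shows "x = y"
  using right_div[of a "a \<otimes> y"] assms m_closed by blast

lemma r_cancel:
  assumes "a \<in> carrier G" "x \<in> carrier G" "y \<in> carrier G" "x \<otimes> a = y \<otimes> a"
  shows "x = y"
  using left_div[of a "y \<otimes> a"] assms m_closed by blast

lemma J_rho_eqI:
  assumes "right_identity G e" "x \<in> carrier G" "y \<in> carrier G" "x \<otimes> y = e"
  shows "J_rho G x = y"
  using l_cancel[of x "J_rho G x" y] J_rho assms by metis

lemma J_lambda_eqI:
  assumes "left_identity G e" "x \<in> carrier G" "y \<in> carrier G" "y \<otimes> x = e"
  shows "J_lambda G x = y"
  using r_cancel[of x "J_lambda G x" y] J_lambda assms by metis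

lemma J_rho_surj:
  assumes "right_identity G e" "z \<in> carrier G"
  shows "\<exists>x \<in> carrier G. J_rho G x = z"
  using left_div[of z e] J_rho_eqI assms by (metis right_identity_def)

lemma J_lambda_surj:
  assumes "left_identity G e" "z \<in> carrier G"
  shows "\<exists>x \<in> carrier G. J_lambda G x = z"
  using right_div[of z e] J_lambda_eqI assms by (metis left_identity_def)

end

section \<open>The automorphism group and its action\<close>

context quasigroup
begin

abbreviation "Aut \<equiv> AutoGroup G"

lemma mem_AutoGroup_iff:
  "\<alpha> \<in> carrier Aut \<longleftrightarrow> \<alpha> \<in> Bij (carrier G) \<and>
     (\<forall>x \<in> carrier G. \<forall>y \<in> carrier G. \<alpha> (x \<otimes> y) = \<alpha> x \<otimes> \<alpha> y)"
  by (auto simp: AutoGroup_def auto_def hom_def dest: Bij_imp_funcset)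

text \<open>
  Closure under composition and inverses uses only that the operation is closed, so the
  automorphisms of a quasigroup form a group just as those of a group do.
\<close>

lemma subgroup_auto: "subgroup (auto G) (BijGroup (carrier G))"
proof (rule subgroup.intro)
  show "auto G \<subseteq> carrier (BijGroup (carrier G))"
    by (auto simp: auto_def BijGroup_def)
next
  fix f g assume "f \<in> auto G" "g \<in> auto G"
  then show "f \<otimes>\<^bsub>BijGroup (carrier G)\<^esub> g \<in> auto G"
    using compose_Bij[of f "carrier G" g]
    by (auto simp: auto_def BijGroup_def hom_def compose_def m_closed Pi_iff)
next
  show "\<one>\<^bsub>BijGroup (carrier G)\<^esub> \<in> auto G"
    by (auto simp: auto_def BijGroup_def hom_def id_Bij m_closed)
next
  fix f assume f: "f \<in> auto G"
  have "inv_into (carrier G) f (x \<otimes> y) = inv_into (carrier G) f x \<otimes> inv_into (carrier G) f y"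
    if "x \<in> carrier G" "y \<in> carrier G" for x y
    by (rule Bij_inv_into_lemma)
      (use f that m_closed in \<open>auto simp: auto_def hom_def\<close>)
  then show "inv\<^bsub>BijGroup (carrier G)\<^esub> f \<in> auto G"
    using f restrict_inv_into_Bij[of f "carrier G"] Bij_inv_into_mem[of f "carrier G"]
    by (auto simp: inv_BijGroup auto_def hom_def m_closed)
qed

lemma group_AutoGroup: "group Aut"
  unfolding AutoGroup_def
  by (intro group.subgroup_imp_group group_BijGroup subgroup_auto)

sublocale A: group "AutoGroup G"
  by (rule group_AutoGroup)

lemma auto_closed [simp]: "\<lbrakk>\<alpha> \<in> carrier Aut; x \<in> carrier G\<rbrakk> \<Longrightarrow> \<alpha> x \<in> carrier G"
  by (auto simp: mem_AutoGroup_iff dest: Bij_imp_funcset)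

lemma auto_mult:
  "\<lbrakk>\<alpha> \<in> carrier Aut; x \<in> carrier G; y \<in> carrier G\<rbrakk> \<Longrightarrow> \<alpha> (x \<otimes> y) = \<alpha> x \<otimes> \<alpha> y"
  by (simp add: mem_AutoGroup_iff)

lemma auto_inj:
  "\<lbrakk>\<alpha> \<in> carrier Aut; x \<in> carrier G; y \<in> carrier G; \<alpha> x = \<alpha> y\<rbrakk> \<Longrightarrow> x = y"
  unfolding mem_AutoGroup_iff Bij_def bij_betw_def by (blast dest: inj_onD)

lemma one_AutoGroup: "\<one>\<^bsub>Aut\<^esub> = (\<lambda>x \<in> carrier G. x)"
  by (simp add: AutoGroup_def BijGroup_def)

lemma one_AutoGroup_apply [simp]: "x \<in> carrier G \<Longrightarrow> \<one>\<^bsub>Aut\<^esub> x = x"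
  by (simp add: one_AutoGroup)

lemma mult_AutoGroup_apply:
  "\<lbrakk>\<alpha> \<in> carrier Aut; \<beta> \<in> carrier Aut; x \<in> carrier G\<rbrakk> \<Longrightarrow> (\<alpha> \<otimes>\<^bsub>Aut\<^esub> \<beta>) x = \<alpha> (\<beta> x)"
  by (auto simp: mem_AutoGroup_iff) (simp add: AutoGroup_def BijGroup_def compose_def)

lemma inv_AutoGroup_apply [simp]:
  assumes "\<alpha> \<in> carrier Aut" "x \<in> carrier G"
  shows "(inv\<^bsub>Aut\<^esub> \<alpha>) (\<alpha> x) = x" "\<alpha> ((inv\<^bsub>Aut\<^esub> \<alpha>) x) = x"
  using assms mult_AutoGroup_apply[of "inv\<^bsub>Aut\<^esub> \<alpha>" \<alpha> x] mult_AutoGroup_apply[of \<alpha> "inv\<^bsub>Aut\<^esub> \<alpha>" x]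
  by simp_all

text \<open>
  A one-sided identity need not be the only idempotent, so being preserved as an idempotent is not
  enough. But \<open>\<alpha> e \<cdot> \<alpha> e = \<alpha> (e \<cdot> e) = \<alpha> e = \<alpha> e \<cdot> e\<close>, and \<open>\<alpha> e\<close> cancels.
\<close>

lemma right_identity_fixed:
  assumes "right_identity G e" "\<alpha> \<in> carrier Aut"
  shows "\<alpha> e = e"
proof -
  have e: "e \<in> carrier G" "e \<otimes> e = e"
    using assms(1) by (auto simp: right_identity_def)
  have "\<alpha> e \<otimes> \<alpha> e = \<alpha> e \<otimes> e"
    using e assms auto_mult[of \<alpha> e e] by (simp add: right_identity_def)
  then show ?thesis
    using l_cancel[of "\<alpha> e" "\<alpha> e" e] e assms(2) by simp
qed

lemma left_identity_fixed:
  assumes "left_identity G e" "\<alpha> \<in> carrier Aut"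
  shows "\<alpha> e = e"
proof -
  have e: "e \<in> carrier G" "e \<otimes> e = e"
    using assms(1) by (auto simp: left_identity_def)
  have "\<alpha> e \<otimes> \<alpha> e = e \<otimes> \<alpha> e"
    using e assms auto_mult[of \<alpha> e e] by (simp add: left_identity_def)
  then show ?thesis
    using r_cancel[of "\<alpha> e" "\<alpha> e" e] e assms(2) by simp
qed

lemma auto_J_rho:
  assumes "right_identity G e" "\<alpha> \<in> carrier Aut" "x \<in> carrier G"
  shows "J_rho G (\<alpha> x) = \<alpha> (J_rho G x)"
  using assms J_rho[OF assms(1,3)] right_identity_fixed[OF assms(1,2)]
  by (intro J_rho_eqI[OF assms(1)]) (simp_all flip: auto_mult)

lemma auto_J_lambda:
  assumes "left_identity G e" "\<alpha> \<in> carrier Aut" "x \<in> carrier G"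
  shows "J_lambda G (\<alpha> x) = \<alpha> (J_lambda G x)"
  using assms J_lambda[OF assms(1,3)] left_identity_fixed[OF assms(1,2)]
  by (intro J_lambda_eqI[OF assms(1)]) (simp_all flip: auto_mult)

text \<open>
  Substituting \<open>\<beta> x\<close> for \<open>x\<close> turns the autotopism condition into a form without inverses, in which
  automorphisms move across a product.
\<close>

lemma autotopism_iff:
  assumes "\<alpha> \<in> carrier Aut" "\<beta> \<in> carrier Aut"
  shows "(inv\<^bsub>Aut\<^esub> \<beta>, \<alpha>, \<lambda>x \<in> carrier G. x) \<in> AUT G \<longleftrightarrow>
    (\<forall>x \<in> carrier G. \<forall>y \<in> carrier G. \<beta> x \<otimes> y = x \<otimes> \<alpha> y)" (is "_ \<longleftrightarrow> ?R")
proof -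
  have "(inv\<^bsub>Aut\<^esub> \<beta>, \<alpha>, \<lambda>x \<in> carrier G. x) \<in> AUT G \<longleftrightarrow>
      (\<forall>x \<in> carrier G. \<forall>y \<in> carrier G. (inv\<^bsub>Aut\<^esub> \<beta>) x \<otimes> \<alpha> y = x \<otimes> y)"
    using assms A.inv_closed[OF assms(2)]
    by (auto simp: AUT_def id_Bij m_closed mem_AutoGroup_iff)
  also have "\<dots> \<longleftrightarrow> ?R"
    using assms by (metis A.inv_closed auto_closed inv_AutoGroup_apply)
  finally show ?thesis .
qed

end

section \<open>The holomorph as a quasigroup\<close>

context quasigroup
begin

lemma carrier_holomorph [simp]: "carrier (holomorph G) = carrier Aut \<times> carrier G"
  by (simp add: holomorph_def)

lemma mult_holomorph [simp]:
  "(\<alpha>, x) \<otimes>\<^bsub>holomorph G\<^esub> (\<beta>, y) = (\<beta> \<otimes>\<^bsub>Aut\<^esub> \<alpha>, \<beta> x \<otimes> y)"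
  by (simp add: holomorph_def)

lemma quasigroup_holomorph: "quasigroup (holomorph G)"
proof
  show "carrier (holomorph G) \<noteq> {}"
    using nonempty A.one_closed by auto
next
  fix u v assume "u \<in> carrier (holomorph G)" "v \<in> carrier (holomorph G)"
  then show "u \<otimes>\<^bsub>holomorph G\<^esub> v \<in> carrier (holomorph G)"
    by (auto simp: m_closed)
next
  fix u w assume "u \<in> carrier (holomorph G)" "w \<in> carrier (holomorph G)"
  then obtain \<alpha> x \<gamma> z where uw: "u = (\<alpha>, x)" "w = (\<gamma>, z)"
    and A: "\<alpha> \<in> carrier Aut" "\<gamma> \<in> carrier Aut" and xz: "x \<in> carrier G" "z \<in> carrier G"
    by auto
  have eq: "\<beta> \<otimes>\<^bsub>Aut\<^esub> \<alpha> = \<gamma> \<longleftrightarrow> \<beta> = \<gamma> \<otimes>\<^bsub>Aut\<^esub> inv\<^bsub>Aut\<^esub> \<alpha>" if "\<beta> \<in> carrier Aut" for \<beta>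
    using A that A.inv_solve_right by auto
  define \<beta> where "\<beta> = \<gamma> \<otimes>\<^bsub>Aut\<^esub> inv\<^bsub>Aut\<^esub> \<alpha>"
  have \<beta>: "\<beta> \<in> carrier Aut" using A by (simp add: \<beta>_def)
  from right_div[of "\<beta> x" z] obtain y where y: "y \<in> carrier G" "\<beta> x \<otimes> y = z"
    and uniq: "\<And>y'. \<lbrakk>y' \<in> carrier G; \<beta> x \<otimes> y' = z\<rbrakk> \<Longrightarrow> y' = y"
    using \<beta> xz auto_closed by metis
  show "\<exists>!v. v \<in> carrier (holomorph G) \<and> u \<otimes>\<^bsub>holomorph G\<^esub> v = w"
  proof (rule ex1I)
    show "(\<beta>, y) \<in> carrier (holomorph G) \<and> u \<otimes>\<^bsub>holomorph G\<^esub> (\<beta>, y) = w"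
      using uw eq \<beta> y by (simp add: \<beta>_def)
  next
    fix v assume v: "v \<in> carrier (holomorph G) \<and> u \<otimes>\<^bsub>holomorph G\<^esub> v = w"
    then obtain \<beta>' y' where v': "v = (\<beta>', y')" "\<beta>' \<in> carrier Aut" "y' \<in> carrier G"
      by auto
    with v uw have "\<beta>' \<otimes>\<^bsub>Aut\<^esub> \<alpha> = \<gamma>" "\<beta>' x \<otimes> y' = z"
      by simp_all
    then show "v = (\<beta>, y)"
      using eq uniq v' by (metis \<beta>_def)
  qed
next
  fix u w assume "u \<in> carrier (holomorph G)" "w \<in> carrier (holomorph G)"
  then obtain \<alpha> x \<gamma> z where uw: "u = (\<alpha>, x)" "w = (\<gamma>, z)"
    and A: "\<alpha> \<in> carrier Aut" "\<gamma> \<in> carrier Aut" and xz: "x \<in> carrier G" "z \<in> carrier G"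
    by auto
  have eq: "\<alpha> \<otimes>\<^bsub>Aut\<^esub> \<beta> = \<gamma> \<longleftrightarrow> \<beta> = inv\<^bsub>Aut\<^esub> \<alpha> \<otimes>\<^bsub>Aut\<^esub> \<gamma>" if "\<beta> \<in> carrier Aut" for \<beta>
    using A that A.inv_solve_left by auto
  define \<beta> where "\<beta> = inv\<^bsub>Aut\<^esub> \<alpha> \<otimes>\<^bsub>Aut\<^esub> \<gamma>"
  have \<beta>: "\<beta> \<in> carrier Aut" using A by (simp add: \<beta>_def)
  from left_div[of x z] obtain t where t: "t \<in> carrier G" "t \<otimes> x = z"
    and uniq: "\<And>t'. \<lbrakk>t' \<in> carrier G; t' \<otimes> x = z\<rbrakk> \<Longrightarrow> t' = t"
    using xz by metis
  \<comment> \<open>The left factor is acted on by \<open>\<alpha>\<close> before it is multiplied by \<open>x\<close>, so the quotient \<open>t\<close> is pulled back.\<close>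
  show "\<exists>!v. v \<in> carrier (holomorph G) \<and> v \<otimes>\<^bsub>holomorph G\<^esub> u = w"
  proof (rule ex1I)
    show "(\<beta>, (inv\<^bsub>Aut\<^esub> \<alpha>) t) \<in> carrier (holomorph G) \<and>
        (\<beta>, (inv\<^bsub>Aut\<^esub> \<alpha>) t) \<otimes>\<^bsub>holomorph G\<^esub> u = w"
      using uw eq \<beta> t A by (simp add: \<beta>_def)
  next
    fix v assume v: "v \<in> carrier (holomorph G) \<and> v \<otimes>\<^bsub>holomorph G\<^esub> u = w"
    then obtain \<beta>' y where v': "v = (\<beta>', y)" "\<beta>' \<in> carrier Aut" "y \<in> carrier G"
      by auto
    with v uw have "\<alpha> \<otimes>\<^bsub>Aut\<^esub> \<beta>' = \<gamma>" "\<alpha> y \<otimes> x = z"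
      by auto
    then have "\<beta>' = \<beta>" "\<alpha> y = t"
      using eq uniq v' A by (auto simp: \<beta>_def)
    then show "v = (\<beta>, (inv\<^bsub>Aut\<^esub> \<alpha>) t)"
      using v' A by auto
  qed
qed

lemma right_identity_holomorph:
  assumes "right_identity G e"
  shows "right_identity (holomorph G) (\<one>\<^bsub>Aut\<^esub>, e)"
  using assms by (auto simp: right_identity_def)

lemma left_identity_holomorph:
  assumes "left_identity G e"
  shows "left_identity (holomorph G) (\<one>\<^bsub>Aut\<^esub>, e)"
  using assms by (auto simp: left_identity_fixed[OF assms] left_identity_def)

lemma ex_right_identity_holomorph_iff:
  "(\<exists>u. right_identity (holomorph G) u) \<longleftrightarrow> (\<exists>e. right_identity G e)"
proof
  assume "\<exists>u. right_identity (holomorph G) u"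
  then obtain \<beta> e where u: "right_identity (holomorph G) (\<beta>, e)"
    by auto
  then have \<beta>: "\<beta> \<in> carrier Aut" and e: "e \<in> carrier G"
    by (auto simp: right_identity_def)
  have *: "\<beta> = \<one>\<^bsub>Aut\<^esub> \<and> \<beta> x \<otimes> e = x" if "x \<in> carrier G" for x
  proof -
    have "(\<one>\<^bsub>Aut\<^esub>, x) \<otimes>\<^bsub>holomorph G\<^esub> (\<beta>, e) = (\<one>\<^bsub>Aut\<^esub>, x)"
      using u that by (simp add: right_identity_def del: mult_holomorph)
    then show ?thesis using \<beta> by auto
  qed
  then have "right_identity G e"
    using e by (metis one_AutoGroup_apply right_identity_def)
  then show "\<exists>e. right_identity G e" ..
qed (use right_identity_holomorph in blast)

lemma ex_left_identity_holomorph_iff: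
  "(\<exists>u. left_identity (holomorph G) u) \<longleftrightarrow> (\<exists>e. left_identity G e)"
proof
  assume "\<exists>u. left_identity (holomorph G) u"
  then obtain \<beta> e where u: "left_identity (holomorph G) (\<beta>, e)"
    by auto
  then have e: "e \<in> carrier G"
    by (auto simp: left_identity_def)
  have "e \<otimes> x = x" if "x \<in> carrier G" for x
  proof -
    have "(\<beta>, e) \<otimes>\<^bsub>holomorph G\<^esub> (\<one>\<^bsub>Aut\<^esub>, x) = (\<one>\<^bsub>Aut\<^esub>, x)"
      using u that by (simp add: left_identity_def del: mult_holomorph)
    then show ?thesis using e by auto
  qed
  then have "left_identity G e"
    using e by (auto simp: left_identity_def)
  then show "\<exists>e. left_identity G e" ..
qed (use left_identity_holomorph in blast)

lemma J_rho_holomorph: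
  assumes e: "right_identity G e" and \<alpha>: "\<alpha> \<in> carrier Aut" and x: "x \<in> carrier G"
  shows "J_rho (holomorph G) (\<alpha>, x) = (inv\<^bsub>Aut\<^esub> \<alpha>, (inv\<^bsub>Aut\<^esub> \<alpha>) (J_rho G x))"
proof (rule quasigroup.J_rho_eqI[OF quasigroup_holomorph right_identity_holomorph[OF e]])
  have "(inv\<^bsub>Aut\<^esub> \<alpha>) x \<otimes> (inv\<^bsub>Aut\<^esub> \<alpha>) (J_rho G x) = e"
    using J_rho[OF e x] \<alpha> x right_identity_fixed[OF e] by (simp flip: auto_mult)
  then show "(\<alpha>, x) \<otimes>\<^bsub>holomorph G\<^esub> (inv\<^bsub>Aut\<^esub> \<alpha>, (inv\<^bsub>Aut\<^esub> \<alpha>) (J_rho G x)) = (\<one>\<^bsub>Aut\<^esub>, e)"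
    using \<alpha> by simp
qed (use J_rho[OF e x] \<alpha> x in auto)

lemma J_lambda_holomorph:
  assumes e: "left_identity G e" and \<alpha>: "\<alpha> \<in> carrier Aut" and x: "x \<in> carrier G"
  shows "J_lambda (holomorph G) (\<alpha>, x) = (inv\<^bsub>Aut\<^esub> \<alpha>, (inv\<^bsub>Aut\<^esub> \<alpha>) (J_lambda G x))"
proof (rule quasigroup.J_lambda_eqI[OF quasigroup_holomorph left_identity_holomorph[OF e]])
  show "(inv\<^bsub>Aut\<^esub> \<alpha>, (inv\<^bsub>Aut\<^esub> \<alpha>) (J_lambda G x)) \<otimes>\<^bsub>holomorph G\<^esub> (\<alpha>, x) = (\<one>\<^bsub>Aut\<^esub>, e)"
    using J_lambda[OF e x] \<alpha> by simp
qed (use J_lambda[OF e x] \<alpha> x in auto)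

end

lemma (in loop) loop_holomorph: "loop (holomorph G)"
proof -
  have e: "right_identity G \<one>" "left_identity G \<one>"
    using one_closed l_one r_one by (auto simp: right_identity_def left_identity_def)
  have one: "\<one>\<^bsub>holomorph G\<^esub> = (\<one>\<^bsub>Aut\<^esub>, \<one>)"
    by (simp add: holomorph_def)
  show ?thesis
    using right_identity_holomorph[OF e(1)] left_identity_holomorph[OF e(2)]
    by (intro loop.intro quasigroup_holomorph loop_axioms.intro)
      (simp_all add: one right_identity_def left_identity_def del: carrier_holomorph)
qed

section \<open>Automorphic inverses in the holomorph\<close>

context quasigroup
begin

text \<open>
  Once the automorphism group is abelian, applying \<open>\<beta>\<close> and \<open>\<alpha>\<close> to the second components of
  \<open>K (u v) = K u \<cdot> K v\<close>, for \<open>u = (\<alpha>, x)\<close> and \<open>v = (\<beta>, y)\<close>, removes all inverses and turns it into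
  the equation \<open>J (\<beta> x \<cdot> y) = J x \<cdot> \<alpha> (J y)\<close>, which no longer mentions the holomorph.
\<close>

lemma holomorph_inverse_map_hom_iff:
  assumes J_closed: "\<And>x. x \<in> carrier G \<Longrightarrow> J x \<in> carrier G"
    and J_surj: "\<And>z. z \<in> carrier G \<Longrightarrow> \<exists>x \<in> carrier G. J x = z"
    and J_auto: "\<And>\<alpha> x. \<lbrakk>\<alpha> \<in> carrier Aut; x \<in> carrier G\<rbrakk> \<Longrightarrow> J (\<alpha> x) = \<alpha> (J x)"
    and K: "\<And>\<alpha> x. \<lbrakk>\<alpha> \<in> carrier Aut; x \<in> carrier G\<rbrakk> \<Longrightarrow>
              K (\<alpha>, x) = (inv\<^bsub>Aut\<^esub> \<alpha>, (inv\<^bsub>Aut\<^esub> \<alpha>) (J x))"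
  shows "(\<forall>u \<in> carrier (holomorph G). \<forall>v \<in> carrier (holomorph G).
            K (u \<otimes>\<^bsub>holomorph G\<^esub> v) = K u \<otimes>\<^bsub>holomorph G\<^esub> K v) \<longleftrightarrow>
         comm_group Aut \<and>
         (\<forall>\<alpha> \<in> carrier Aut. \<forall>\<beta> \<in> carrier Aut.
            (inv\<^bsub>Aut\<^esub> \<beta>, \<alpha>, \<lambda>x \<in> carrier G. x) \<in> AUT G) \<and>
         (\<forall>x \<in> carrier G. \<forall>y \<in> carrier G. J (x \<otimes> y) = J x \<otimes> J y)"
    (is "?hol \<longleftrightarrow> ?comm \<and> ?atp \<and> ?hom")
proof -
  have atp: "?atp \<longleftrightarrow> (\<forall>\<alpha> \<in> carrier Aut. \<forall>\<beta> \<in> carrier Aut.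
      \<forall>x \<in> carrier G. \<forall>y \<in> carrier G. \<beta> x \<otimes> y = x \<otimes> \<alpha> y)"
    by (simp add: autotopism_iff)
  have fst_eq: "?hol \<Longrightarrow> ?comm"
  proof (rule A.group_comm_groupI)
    fix \<alpha> \<beta> assume hol: ?hol and A: "\<alpha> \<in> carrier Aut" "\<beta> \<in> carrier Aut"
    obtain x where x: "x \<in> carrier G" using nonempty by blast
    \<comment> \<open>The inverses in these elements are undone by \<open>K\<close>, which leaves \<open>\<alpha>\<close> and \<open>\<beta>\<close> themselves.\<close>
    have "K ((inv\<^bsub>Aut\<^esub> \<beta>, x) \<otimes>\<^bsub>holomorph G\<^esub> (inv\<^bsub>Aut\<^esub> \<alpha>, x)) =
        K (inv\<^bsub>Aut\<^esub> \<beta>, x) \<otimes>\<^bsub>holomorph G\<^esub> K (inv\<^bsub>Aut\<^esub> \<alpha>, x)"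
      using hol A x by (simp del: mult_holomorph)
    then show "\<alpha> \<otimes>\<^bsub>Aut\<^esub> \<beta> = \<beta> \<otimes>\<^bsub>Aut\<^esub> \<alpha>"
      using A x by (simp add: K m_closed A.inv_mult_group)
  qed
  have snd_eq: "K ((\<alpha>, x) \<otimes>\<^bsub>holomorph G\<^esub> (\<beta>, y)) = K (\<alpha>, x) \<otimes>\<^bsub>holomorph G\<^esub> K (\<beta>, y) \<longleftrightarrow>
      J (\<beta> x \<otimes> y) = J x \<otimes> \<alpha> (J y)"
    if ?comm and A: "\<alpha> \<in> carrier Aut" "\<beta> \<in> carrier Aut" and xy: "x \<in> carrier G" "y \<in> carrier G"
    for \<alpha> x \<beta> y
  proof -
    interpret comm_group Aut by fact
    let ?\<alpha>' = "inv\<^bsub>Aut\<^esub> \<alpha>" and ?\<beta>' = "inv\<^bsub>Aut\<^esub> \<beta>" and ?\<delta> = "\<beta> \<otimes>\<^bsub>Aut\<^esub> \<alpha>"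
    have \<delta>: "?\<delta> \<in> carrier Aut" using A by simp
    \<comment> \<open>The product \<open>\<beta>\<alpha>\<close> acts as \<open>\<alpha>\<close> after \<open>\<beta>\<close>: commuted, it peels the nested inverses off one by one.\<close>
    have \<delta>_apply: "?\<delta> z = \<alpha> (\<beta> z)" if "z \<in> carrier G" for z
      using A that by (metis m_comm mult_AutoGroup_apply)
    have J: "J x \<in> carrier G" "J y \<in> carrier G" "J (\<beta> x \<otimes> y) \<in> carrier G"
      using A xy by (simp_all add: J_closed m_closed)
    have inv_\<delta>: "inv\<^bsub>Aut\<^esub> ?\<delta> = ?\<beta>' \<otimes>\<^bsub>Aut\<^esub> ?\<alpha>'"
      using A by (simp add: inv_mult)
    have "K ((\<alpha>, x) \<otimes>\<^bsub>holomorph G\<^esub> (\<beta>, y)) = K (\<alpha>, x) \<otimes>\<^bsub>holomorph G\<^esub> K (\<beta>, y) \<longleftrightarrow>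
        (inv\<^bsub>Aut\<^esub> ?\<delta>) (J (\<beta> x \<otimes> y)) = ?\<beta>' (?\<alpha>' (J x)) \<otimes> ?\<beta>' (J y)" (is "_ \<longleftrightarrow> ?l = ?r")
      using A xy \<delta> by (simp add: K m_closed inv_\<delta>)
    also have "\<dots> \<longleftrightarrow> ?\<delta> ?l = ?\<delta> ?r"
    proof -
      have "?l \<in> carrier G" "?r \<in> carrier G"
        using A J \<delta> by (simp_all add: m_closed)
      from auto_inj[OF \<delta> this] show ?thesis by metis
    qed
    also have "?\<delta> ?l = J (\<beta> x \<otimes> y)"
      using \<delta> J by simp
    also have "?\<delta> ?r = J x \<otimes> \<alpha> (J y)"
      using A J \<delta> by (simp add: \<delta>_apply auto_mult m_closed)
    finally show ?thesis .
  qed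
  have swap_eq: "J (\<beta> x \<otimes> y) = \<beta> (J x) \<otimes> J y"
    if ?hom "\<beta> \<in> carrier Aut" "x \<in> carrier G" "y \<in> carrier G" for \<beta> x y
    using that by (simp add: J_auto)
  show ?thesis
  proof
    assume hol: ?hol
    note comm = fst_eq[OF hol]
    have eq: "J (\<beta> x \<otimes> y) = J x \<otimes> \<alpha> (J y)"
      if "\<alpha> \<in> carrier Aut" "\<beta> \<in> carrier Aut" "x \<in> carrier G" "y \<in> carrier G" for \<alpha> x \<beta> y
      using hol snd_eq[OF comm that] that by (simp del: mult_holomorph)
    have hom: ?hom
      using eq[OF A.one_closed A.one_closed] by (simp add: J_closed)
    have "\<beta> p \<otimes> q = p \<otimes> \<alpha> q"
      if A: "\<alpha> \<in> carrier Aut" "\<beta> \<in> carrier Aut" and pq: "p \<in> carrier G" "q \<in> carrier G"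
      for \<alpha> \<beta> p q
    proof -
      obtain x y where "x \<in> carrier G" "J x = p" "y \<in> carrier G" "J y = q"
        using J_surj pq by metis
      then show ?thesis
        using eq swap_eq[OF hom] A by metis
    qed
    with comm hom show "?comm \<and> ?atp \<and> ?hom"
      unfolding atp by blast
  next
    assume "?comm \<and> ?atp \<and> ?hom"
    then have comm: ?comm and atp': ?atp and hom: ?hom by blast+
    have "K ((\<alpha>, x) \<otimes>\<^bsub>holomorph G\<^esub> (\<beta>, y)) = K (\<alpha>, x) \<otimes>\<^bsub>holomorph G\<^esub> K (\<beta>, y)"
      if "\<alpha> \<in> carrier Aut" "\<beta> \<in> carrier Aut" "x \<in> carrier G" "y \<in> carrier G" for \<alpha> x \<beta> y
      unfolding snd_eq[OF comm that] using swap_eq[OF hom] atp' that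
      by (simp add: atp J_closed)
    then show ?hol
      by (auto simp del: mult_holomorph)
  qed
qed

lemma right_AIP_holomorph_iff:
  "right_AIP (holomorph G) \<longleftrightarrow>
     comm_group Aut \<and>
     (\<forall>\<alpha> \<in> carrier Aut. \<forall>\<beta> \<in> carrier Aut.
        (inv\<^bsub>Aut\<^esub> \<beta>, \<alpha>, \<lambda>x \<in> carrier G. x) \<in> AUT G) \<and>
     right_AIP G"
proof (cases "\<exists>e. right_identity G e")
  case True
  then obtain e where e: "right_identity G e" by blast
  show ?thesis
    unfolding right_AIP_def ex_right_identity_holomorph_iff
    by (simp only: True simp_thms, rule holomorph_inverse_map_hom_iff[of "J_rho G"])
      (rule J_rho(1)[OF e] J_rho_surj[OF e] auto_J_rho[OF e] J_rho_holomorph[OF e]; assumption)+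
next
  case False
  then show ?thesis
    unfolding right_AIP_def ex_right_identity_holomorph_iff by (simp only: simp_thms)
qed

lemma left_AIP_holomorph_iff:
  "left_AIP (holomorph G) \<longleftrightarrow>
     comm_group Aut \<and>
     (\<forall>\<alpha> \<in> carrier Aut. \<forall>\<beta> \<in> carrier Aut.
        (inv\<^bsub>Aut\<^esub> \<beta>, \<alpha>, \<lambda>x \<in> carrier G. x) \<in> AUT G) \<and>
     left_AIP G"
proof (cases "\<exists>e. left_identity G e")
  case True
  then obtain e where e: "left_identity G e" by blast
  show ?thesis
    unfolding left_AIP_def ex_left_identity_holomorph_iff
    by (simp only: True simp_thms, rule holomorph_inverse_map_hom_iff[of "J_lambda G"])
      (rule J_lambda(1)[OF e] J_lambda_surj[OF e] auto_J_lambda[OF e] J_lambda_holomorph[OF e]; assumption)+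
next
  case False
  then show ?thesis
    unfolding left_AIP_def ex_left_identity_holomorph_iff by (simp only: simp_thms)
qed

end


theorem theorem2p1:
  fixes L :: "('a, 'b) monoid_scheme"
  shows "(quasigroup L \<longrightarrow>
           (AIPQ (holomorph L) \<longleftrightarrow>
              comm_group (AutoGroup L) \<and>
              (\<forall>\<alpha> \<in> carrier (AutoGroup L). \<forall>\<beta> \<in> carrier (AutoGroup L).
                 (inv\<^bsub>AutoGroup L\<^esub> \<beta>, \<alpha>, \<lambda>x \<in> carrier L. x) \<in> AUT L) \<and>
              AIPQ L)) \<and>
         (loop L \<longrightarrow>
           (AIPL (holomorph L) \<longleftrightarrow>
              comm_group (AutoGroup L) \<and>
              (\<forall>\<alpha> \<in> carrier (AutoGroup L). \<forall>\<beta> \<in> carrier (AutoGroup L).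
                 (inv\<^bsub>AutoGroup L\<^esub> \<beta>, \<alpha>, \<lambda>x \<in> carrier L. x) \<in> AUT L) \<and>
              AIPL L))"
proof (intro conjI impI)
  assume "quasigroup L"
  then show "AIPQ (holomorph L) \<longleftrightarrow>
      comm_group (AutoGroup L) \<and>
      (\<forall>\<alpha> \<in> carrier (AutoGroup L). \<forall>\<beta> \<in> carrier (AutoGroup L).
         (inv\<^bsub>AutoGroup L\<^esub> \<beta>, \<alpha>, \<lambda>x \<in> carrier L. x) \<in> AUT L) \<and>
      AIPQ L"
    unfolding AIPQ_def
    by (simp add: quasigroup.quasigroup_holomorph quasigroup.right_AIP_holomorph_iff
        quasigroup.left_AIP_holomorph_iff conj_disj_distribL)
next
  assume "loop L"
  then show "AIPL (holomorph L) \<longleftrightarrow>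
      comm_group (AutoGroup L) \<and>
      (\<forall>\<alpha> \<in> carrier (AutoGroup L). \<forall>\<beta> \<in> carrier (AutoGroup L).
         (inv\<^bsub>AutoGroup L\<^esub> \<beta>, \<alpha>, \<lambda>x \<in> carrier L. x) \<in> AUT L) \<and>
      AIPL L"
    unfolding AIPL_def
    by (simp add: loop.loop_holomorph loop.axioms(1) quasigroup.right_AIP_holomorph_iff
        quasigroup.left_AIP_holomorph_iff conj_disj_distribL)
qed

end
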